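(* Let $G=\operatorname{diag}(\varepsilon_0,\varepsilon_1,\varepsilon_2,\dots)$ be a semi-infinite diagonal matrix with $\varepsilon_j\in\{+1,-1\}$ for all $j$, let $\widetilde J$ be a real semi-infinite $G$-symmetric tridiagonal matrix, and let $x\in\mathbb R$. Then $\widetilde J$ corresponds to the signed measure $(t-x)\,d\mu(t)$ for some positive measure $d\mu$ on $\mathbb R$ if and only if $\widetilde J$ admits the representation $$\widetilde J=GL^{\top}L+xI,$$ where $L$ is a real semi-infinite lower bidiagonal matrix of the form $$L=\begin{pmatrix} l_0&0&0&\cdots\\ m_0&l_1&0&\\ 0&m_1&l_2&\ddots\\ \vdots&&\ddots&\ddots\end{pmatrix},\qquad l_j>0,\ m_j\neq 0\quad (j=0,1,2,\dots).$$
   Context: All matrices are indexed by $\{0,1,2,\dots\}$, and all matrix products occurring are well defined since the matrices are banded. A matrix $H$ is called $G$-symmetric if $GH$ is symmetric. Positive measures are understood to have finite moments of all orders; their support is not required to be bounded, and the statement is purely algebraic. A $G$-symmetric tridiagonal matrix $\widetilde J$, with $G=\operatorname{diag}(\varepsilon_0,\varepsilon_1,\dots)$, is said to correspond to a signed measure $d\nu$ if there is a sequence of real polynomials $\widetilde P_0,\widetilde P_1,\dots$ with $\deg\widetilde P_n=n$ such that $\int \widetilde P_n(t)\widetilde P_m(t)\,d\nu(t)=\varepsilon_n\delta_{nm}$ for all $n,m\ge 0$ and $\widetilde J\,\widetilde p(t)=t\,\widetilde p(t)$, where $\widetilde p(t)=(\widetilde P_0(t),\widetilde P_1(t),\dots)^{\top}$.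 *)

theory Defs
  imports "HOL-Analysis.Analysis" "HOL-Computational_Algebra.Polynomial"
begin

type_synonym inf_matrix = "nat \<Rightarrow> nat \<Rightarrow> real"

text \<open>All matrices multiplied below are banded, so every series in the two following definitions has
  only finitely many nonzero terms and is a finite sum.\<close>

definition mat_mult :: "inf_matrix \<Rightarrow> inf_matrix \<Rightarrow> inf_matrix"  (infixl "\<cdot>\<^sub>M" 70) where
  "A \<cdot>\<^sub>M B = (\<lambda>i j. \<Sum>k. A i k * B k j)"

definition mat_vec :: "inf_matrix \<Rightarrow> (nat \<Rightarrow> real) \<Rightarrow> nat \<Rightarrow> real"  (infixl "\<cdot>\<^sub>V" 70) where
  "A \<cdot>\<^sub>V v = (\<lambda>i. \<Sum>k. A i k * v k)"

definition mat_add :: "inf_matrix \<Rightarrow> inf_matrix \<Rightarrow> inf_matrix"  (infixl "+\<^sub>M" 65) where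
  "A +\<^sub>M B = (\<lambda>i j. A i j + B i j)"

definition mat_scale :: "real \<Rightarrow> inf_matrix \<Rightarrow> inf_matrix"  (infixr "*\<^sub>M" 75) where
  "c *\<^sub>M A = (\<lambda>i j. c * A i j)"

definition mat_transpose :: "inf_matrix \<Rightarrow> inf_matrix" where
  "mat_transpose A = (\<lambda>i j. A j i)"

definition mat_diag :: "(nat \<Rightarrow> real) \<Rightarrow> inf_matrix" where
  "mat_diag d = (\<lambda>i j. if i = j then d i else 0)"

definition mat_id :: inf_matrix where
  "mat_id = mat_diag (\<lambda>_. 1)"

definition mat_symmetric :: "inf_matrix \<Rightarrow> bool" where
  "mat_symmetric A \<longleftrightarrow> mat_transpose A = A"

definition G_symmetric :: "inf_matrix \<Rightarrow> inf_matrix \<Rightarrow> bool" where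
  "G_symmetric G H \<longleftrightarrow> mat_symmetric (G \<cdot>\<^sub>M H)"

definition tridiagonal :: "inf_matrix \<Rightarrow> bool" where
  "tridiagonal A \<longleftrightarrow> (\<forall>i j. Suc i < j \<or> Suc j < i \<longrightarrow> A i j = 0)"

definition lower_bidiagonal :: "(nat \<Rightarrow> real) \<Rightarrow> (nat \<Rightarrow> real) \<Rightarrow> inf_matrix" where
  "lower_bidiagonal l m = (\<lambda>i j. if i = j then l j else if i = Suc j then m j else 0)"

definition positive_measure :: "real measure \<Rightarrow> bool" where
  "positive_measure M \<longleftrightarrow> sets M = sets borel \<and> (\<forall>n. integrable M (\<lambda>t. t ^ n))"

text \<open>A signed measure is represented by a pair of positive measures, of which it is the difference
  (as in the Jordan decomposition).\<close>

type_synonym signed_measure = "real measure \<times> real measure"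

definition is_signed_measure :: "signed_measure \<Rightarrow> bool" where
  "is_signed_measure \<nu> \<longleftrightarrow> positive_measure (fst \<nu>) \<and> positive_measure (snd \<nu>)"

definition signed_integral :: "signed_measure \<Rightarrow> (real \<Rightarrow> real) \<Rightarrow> real" where
  "signed_integral \<nu> f = (LINT t|fst \<nu>. f t) - (LINT t|snd \<nu>. f t)"

text \<open>The signed measure \<open>w d\<mu>\<close>: since \<^const>\<open>ennreal\<close> truncates negative numbers to \<open>0\<close>, the two
  densities are the positive and the negative part of \<open>w\<close>.\<close>

definition signed_density :: "real measure \<Rightarrow> (real \<Rightarrow> real) \<Rightarrow> signed_measure" where
  "signed_density \<mu> w = (density \<mu> (\<lambda>t. ennreal (w t)), density \<mu> (\<lambda>t. ennreal (- w t)))"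

definition corresponds_to :: "(nat \<Rightarrow> real) \<Rightarrow> inf_matrix \<Rightarrow> signed_measure \<Rightarrow> bool" where
  "corresponds_to \<epsilon> J \<nu> \<longleftrightarrow> is_signed_measure \<nu> \<and>
     (\<exists>P :: nat \<Rightarrow> real poly.
        (\<forall>n. degree (P n) = n) \<and>
        (\<forall>n m. signed_integral \<nu> (\<lambda>t. poly (P n) t * poly (P m) t) = (if n = m then \<epsilon> n else 0)) \<and>
        (\<forall>t. J \<cdot>\<^sub>V (\<lambda>n. poly (P n) t) = (\<lambda>n. t * poly (P n) t)))"

end

theory Submission
  imports Defs "HOL-Probability.Probability"
    "HOL-Computational_Algebra.Fundamental_Theorem_Algebra"
begin

text \<open>
  Let \<open>q\<close> be the vector of orthonormal polynomials of \<open>\<mu>\<close> and \<open>p\<close> the vector of \<open>G\<close>-orthonormal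
  polynomials of \<open>(t - x) d\<mu>\<close>, with leading coefficients of the same signs. Expanding \<open>q\<close> in \<open>p\<close> and
  \<open>(t - x) p\<close> in \<open>q\<close> and using both orthogonality relations gives \<open>q = L p\<close> and
  \<open>(t - x) p = G L\<^sup>T q\<close> with the same bidiagonal \<open>L\<close> (the Christoffel transformation), hence
  \<open>(t - x) p = G L\<^sup>T L p\<close>, which determines the tridiagonal matrix.

  Conversely, \<open>L G L\<^sup>T + x I\<close> is a symmetric Jacobi matrix with nonzero off-diagonal entries, so by
  Favard's theorem its polynomials \<open>q\<close> are orthonormal for a positive measure \<open>\<mu>\<close>, and
  the solution \<open>p\<close> of \<open>L p = q\<close> is the required sequence. The measure in Favard's theorem is a
  weak limit, provided by Helly's selection theorem, of the Gauss quadrature measures at the zeros of the \<open>q\<^sub>N\<close>; the moments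
  converge because the moments of each order are eventually constant.
\<close>

section \<open>Orthogonal polynomials of a functional\<close>

text \<open>Only linearity is assumed, so that the same results serve integration against
  \<open>\<mu>\<close>, which is positive, and against \<open>(t - x) d\<mu>\<close>, which may be
  indefinite.\<close>

locale poly_functional =
  fixes F :: "real poly \<Rightarrow> real"
  assumes add: "F (p + q) = F p + F q"
    and smult: "F (smult c p) = c * F p"
begin

lemma zero [simp]: "F 0 = 0"
  using smult[of 0 0] by simp

lemma diff: "F (p - q) = F p - F q"
  using add[of "p - q" q] by simp

lemma sum: "F (\<Sum>i\<in>A. f i) = (\<Sum>i\<in>A. F (f i))"
  by (induction A rule: infinite_finite_induct) (simp_all add: add)

text \<open>Orthogonality of \<open>P n\<close> to lower degrees (the case \<open>degree p < n\<close>) is included, since then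
  \<open>coeff p n = 0\<close>.\<close>

lemma orthogonal_lead_coeff:
  assumes deg: "\<And>n. degree (P n) = n" and P0: "P 0 \<noteq> 0"
    and orth: "\<And>i j. i \<noteq> j \<Longrightarrow> F (P i * P j) = 0"
    and "degree p \<le> n"
  shows "F (P n * p) * coeff (P n) n = coeff p n * F (P n * P n)"
proof -
  have nz: "coeff (P k) k \<noteq> 0" for k
    by (metis P0 deg leading_coeff_0_iff degree_0)
  \<comment> \<open>Induction on the degree: a multiple of \<open>P k\<close> cancels the leading
    term and is itself orthogonal to \<open>P n\<close>. The alternative \<open>q = 0\<close> covers
    \<open>n = 0\<close>, where no degree lies below \<open>n\<close>.\<close>
  have low: "F (P n * q) = 0" if "degree q < n \<or> q = 0" for q
    using that
  proof (induction "degree q" arbitrary: q rule: less_induct)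
    case less
    show ?case
    proof (cases "q = 0")
      case False
      define k where "k = degree q"
      define r where "r = q - smult (coeff q k / coeff (P k) k) (P k)"
      have q: "q = r + smult (coeff q k / coeff (P k) k) (P k)"
        by (simp add: r_def)
      have "degree r \<le> k"
        unfolding r_def by (intro degree_diff_le) (auto simp: k_def deg)
      moreover have "coeff r k = 0"
        by (simp add: r_def nz)
      ultimately have "degree r < k \<or> r = 0"
        by (metis le_neq_implies_less leading_coeff_0_iff)
      then have "F (P n * r) = 0"
        using less False by (cases "r = 0") (auto simp: k_def)
      then show ?thesis
        using less False orth[of n k] by (subst q) (auto simp: distrib_left add smult k_def)
    qed simp
  qed
  define r where "r = p - smult (coeff p n / coeff (P n) n) (P n)"
  have "degree r \<le> n"
    unfolding r_def by (intro degree_diff_le) (use assms in auto)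
  moreover have "coeff r n = 0"
    by (simp add: r_def nz)
  ultimately have "F (P n * r) = 0"
    by (intro low) (metis le_neq_implies_less leading_coeff_0_iff)
  then show ?thesis
    using nz by (simp add: r_def right_diff_distrib diff smult field_simps)
qed

text \<open>A nonzero difference of degree \<open>k\<close> is detected by \<open>P k\<close>: the
  product is its leading coefficient times the nonzero \<open>F (P k * P k)\<close>. Nondegeneracy
  replaces positivity here, as the indefinite functional requires.\<close>

lemma eq_if_products_eq:
  assumes deg: "\<And>n. degree (P n) = n" and P0: "P 0 \<noteq> 0"
    and orth: "\<And>i j. i \<noteq> j \<Longrightarrow> F (P i * P j) = 0"
    and nondeg: "\<And>i. F (P i * P i) \<noteq> 0"
    and eq: "\<And>k. F (P k * p) = F (P k * q)"
  shows "p = q"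
proof (rule ccontr)
  assume "p \<noteq> q"
  define k where "k = degree (p - q)"
  have "coeff (p - q) k * F (P k * P k) = 0"
    using orthogonal_lead_coeff[OF deg P0 orth, of "p - q" k] eq
    by (simp add: k_def right_diff_distrib diff)
  then show False
    using nondeg[of k] \<open>p \<noteq> q\<close> by (simp add: k_def del: coeff_diff)
qed

text \<open>Gram-Schmidt: subtract from the monomial of degree \<open>n\<close> its projection onto
  the earlier polynomials. Positivity makes the denominators nonzero.\<close>

lemma exists_monic_orthogonal:
  assumes pos: "\<And>p. p \<noteq> 0 \<Longrightarrow> F (p * p) > 0"
  shows "\<exists>r. degree r = n \<and> lead_coeff r = 1 \<and> (\<forall>p. degree p < n \<longrightarrow> F (r * p) = 0)"
proof (induction n rule: less_induct)
  case (less n)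
  then obtain R where R: "\<And>k. k < n \<Longrightarrow> degree (R k) = k \<and> lead_coeff (R k) = 1 \<and>
      (\<forall>p. degree p < k \<longrightarrow> F (R k * p) = 0)"
    by metis
  have orth: "F (R i * R j) = 0" if "i < n" "j < n" "i \<noteq> j" for i j
    using that R[of i] R[of j] by (cases "i < j") (auto simp: mult.commute[of "R i"])
  have Rnz: "F (R i * R i) \<noteq> 0" if "i < n" for i
    using pos[of "R i"] R[OF that] by fastforce
  define s where "s = (\<Sum>k<n. smult (F (monom 1 n * R k) / F (R k * R k)) (R k))"
  define r where "r = monom 1 n - s"
  have s: "degree s < n \<or> s = 0"
  proof (cases n)
    case (Suc m)
    have "degree s \<le> m"
      unfolding s_def
      by (intro degree_sum_le) (use R Suc in \<open>auto intro: order_trans[OF degree_smult_le]\<close>)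
    then show ?thesis using Suc by simp
  qed (simp add: s_def)
  have cs: "coeff s n = 0"
    using s by (auto simp: coeff_eq_0)
  have degr: "degree r = n"
  proof (rule antisym)
    show "degree r \<le> n"
      unfolding r_def using s by (intro degree_diff_le) (auto simp: degree_monom_le)
    show "n \<le> degree r"
      by (rule le_degree) (simp add: r_def cs)
  qed
  have rR: "F (r * R k) = 0" if "k < n" for k
  proof -
    have "F (s * R k) = (\<Sum>i<n. F (monom 1 n * R i) / F (R i * R i) * F (R i * R k))"
      by (simp add: s_def sum_distrib_right sum smult)
    also have "\<dots> = (\<Sum>i<n. if i = k then F (monom 1 n * R k) else 0)"
      by (intro sum.cong) (use that Rnz orth in auto)
    finally show ?thesis
      using that by (simp add: r_def left_diff_distrib diff)
  qed
  have "F (r * p) = 0" if "degree p < n" for p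
    using that
  proof (induction "degree p" arbitrary: p rule: less_induct)
    case (less p)
    define k where "k = degree p"
    have k: "k < n" using less by (simp add: k_def)
    define q where "q = p - smult (coeff p k) (R k)"
    have p: "p = q + smult (coeff p k) (R k)"
      by (simp add: q_def)
    have "degree q \<le> k"
      unfolding q_def using R[OF k] by (intro degree_diff_le) (auto simp: k_def)
    moreover have "coeff q k = 0"
    proof -
      have "coeff (R k) k = 1"
        using R[OF k] by metis
      then show ?thesis
        by (simp add: q_def)
    qed
    ultimately have "degree q < k \<or> q = 0"
      by (metis le_neq_implies_less leading_coeff_0_iff)
    then have "F (r * q) = 0"
      using less by (cases "q = 0") (auto simp: k_def)
    then show ?case
      using rR[OF k] by (subst p) (simp add: distrib_left add smult)
  qed
  moreover have "lead_coeff r = 1"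
    unfolding degr by (simp add: r_def cs)
  ultimately show ?case
    using degr by blast
qed

text \<open>Normalization leaves the sign of each polynomial free. The prescribed signs
  \<open>c\<close> are what later makes the diagonal of \<open>L\<close> positive.\<close>

lemma exists_orthonormal:
  assumes pos: "\<And>p. p \<noteq> 0 \<Longrightarrow> F (p * p) > 0"
    and c: "\<And>n. c n \<in> {1, -1}"
  shows "\<exists>Q. (\<forall>n. degree (Q n) = n \<and> c n * coeff (Q n) n > 0) \<and>
    (\<forall>i j. F (Q i * Q j) = (if i = j then 1 else 0))"
proof -
  obtain R where R: "\<And>n. degree (R n) = n" "\<And>n. lead_coeff (R n) = 1"
      "\<And>n p. degree p < n \<Longrightarrow> F (R n * p) = 0"
    using exists_monic_orthogonal[OF pos] by metis
  have orth: "F (R i * R j) = 0" if "i \<noteq> j" for i j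
    using that R(3)[of "R j" i] R(3)[of "R i" j] R(1)
    by (cases "i < j") (auto simp: mult.commute[of "R i"])
  have posR: "F (R i * R i) > 0" for i
    using pos[of "R i"] R(2)[of i] by fastforce
  have cc: "c n * c n = 1" for n
    using c[of n] by auto
  define Q where "Q n = smult (c n / sqrt (F (R n * R n))) (R n)" for n
  have "c n * coeff (Q n) n > 0" for n
    using posR[of n] R(1,2)[of n] cc[of n] by (simp add: Q_def)
  moreover have "degree (Q n) = n" for n
    using posR[of n] R(1)[of n] cc[of n] by (auto simp: Q_def)
  moreover have "F (Q i * Q j) = (if i = j then 1 else 0)" for i j
    using orth[of i j] posR[of i] cc[of i]
    by (auto simp: Q_def smult real_sqrt_mult_self field_simps)
  ultimately show ?thesis by blast
qed

end

section \<open>Polynomial bases with one element of each degree\<close>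

lemma degree_basis_independent:
  fixes P :: "nat \<Rightarrow> real poly"
  assumes deg: "\<And>k. degree (P k) = k" and P0: "P 0 \<noteq> 0"
    and "(\<Sum>k<n. smult (c k) (P k)) = 0" "k < n"
  shows "c k = 0"
  using assms(3,4)
proof (induction n)
  case (Suc n)
  have nz: "coeff (P n) n \<noteq> 0"
    by (metis P0 deg leading_coeff_0_iff degree_0)
  have "coeff (\<Sum>k<Suc n. smult (c k) (P k)) n = c n * coeff (P n) n"
    by (auto simp: coeff_sum coeff_eq_0 deg)
  then have "c n = 0"
    by (metis Suc.prems(1) nz coeff_0 mult_eq_0_iff)
  then show ?case
    using Suc by (cases "k = n") auto
qed simp

lemma degree_basis_span:
  fixes P :: "nat \<Rightarrow> real poly"
  assumes deg: "\<And>k. degree (P k) = k" and P0: "P 0 \<noteq> 0"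
  shows "degree p < n \<Longrightarrow> \<exists>c. p = (\<Sum>k<n. smult (c k) (P k))"
proof (induction n arbitrary: p)
  case (Suc n)
  have nz: "coeff (P n) n \<noteq> 0"
    by (metis P0 deg leading_coeff_0_iff degree_0)
  define r where "r = p - smult (coeff p n / coeff (P n) n) (P n)"
  have p: "p = r + smult (coeff p n / coeff (P n) n) (P n)"
    by (simp add: r_def)
  have "degree r \<le> n"
    unfolding r_def using Suc.prems by (intro degree_diff_le) (auto simp: deg)
  moreover have "coeff r n = 0"
    using nz by (simp add: r_def)
  ultimately have r: "degree r < n \<or> r = 0"
    by (metis le_neq_implies_less leading_coeff_0_iff)
  obtain c where c: "r = (\<Sum>k<n. smult (c k) (P k))"
  proof (cases "r = 0")
    case True
    then show ?thesis by (intro that[of "\<lambda>_. 0"]) simp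
  next
    case False
    then show ?thesis using r Suc.IH that by blast
  qed
  have "p = (\<Sum>k<Suc n. smult ((c(n := coeff p n / coeff (P n) n)) k) (P k))"
    by (subst p, subst c) (auto intro!: sum.cong)
  then show ?case by blast
qed simp

section \<open>Tridiagonal matrices\<close>

lemma mat_vec_tridiagonal:
  assumes "tridiagonal A"
  shows "(A \<cdot>\<^sub>V v) n = (\<Sum>k<n+2. A n k * v k)"
  unfolding mat_vec_def using assms
  by (intro suminf_finite) (auto simp: tridiagonal_def)

text \<open>Row \<open>n\<close> of the equation, read for all \<open>t\<close>, is a linear
  relation among \<open>P 0\<close>, ..., \<open>P (n+1)\<close>, and these are linearly
  independent.\<close>

lemma tridiagonal_eqI:
  fixes P :: "nat \<Rightarrow> real poly"
  assumes "tridiagonal A" "tridiagonal B"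
    and deg: "\<And>k. degree (P k) = k" and P0: "P 0 \<noteq> 0"
    and eq: "\<And>t. A \<cdot>\<^sub>V (\<lambda>n. poly (P n) t) = B \<cdot>\<^sub>V (\<lambda>n. poly (P n) t)"
  shows "A = B"
proof (intro ext)
  fix n k
  have "(\<Sum>k<n+2. smult (A n k - B n k) (P k)) = 0"
  proof (subst poly_eq_poly_eq_iff[symmetric], rule ext)
    fix t
    show "poly (\<Sum>k<n+2. smult (A n k - B n k) (P k)) t = poly 0 t"
      using fun_cong[OF eq[of t], of n] assms(1,2)
      by (simp add: mat_vec_tridiagonal poly_sum left_diff_distrib sum_subtractf)
  qed
  from degree_basis_independent[OF deg P0 this, of k] show "A n k = B n k"
    using assms(1,2) by (cases "k < n + 2") (auto simp: tridiagonal_def)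
qed

lemma GLtL_entries:
  "(mat_diag e \<cdot>\<^sub>M (mat_transpose (lower_bidiagonal l m) \<cdot>\<^sub>M lower_bidiagonal l m)
      +\<^sub>M x *\<^sub>M mat_id) i j =
    (if i = j then e i * ((l i)\<^sup>2 + (m i)\<^sup>2) + x
     else if j = Suc i then e i * m i * l j
     else if i = Suc j then e i * m j * l i else 0)"
proof -
  \<comment> \<open>Column \<open>i\<close> of \<open>L\<close> lives in rows \<open>i\<close> and
    \<open>i + 1\<close>, so the series collapses to two terms.\<close>
  have 1: "(mat_transpose (lower_bidiagonal l m) \<cdot>\<^sub>M lower_bidiagonal l m) i j =
    (\<Sum>k\<in>{i, Suc i}. lower_bidiagonal l m k i * lower_bidiagonal l m k j)" for i j
    unfolding mat_mult_def mat_transpose_def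
    by (intro suminf_finite) (auto simp: lower_bidiagonal_def)
  have 2: "(mat_diag e \<cdot>\<^sub>M B) i j = (\<Sum>k\<in>{i}. mat_diag e i k * B k j)" for B i j
    unfolding mat_mult_def by (intro suminf_finite) (auto simp: mat_diag_def)
  show ?thesis
    by (auto simp: mat_add_def mat_scale_def mat_id_def 2 1)
      (auto simp: mat_diag_def lower_bidiagonal_def power2_eq_square algebra_simps)
qed

lemma GLtL_tridiagonal:
  "tridiagonal (mat_diag e \<cdot>\<^sub>M (mat_transpose (lower_bidiagonal l m) \<cdot>\<^sub>M lower_bidiagonal l m)
      +\<^sub>M x *\<^sub>M mat_id)"
  by (auto simp: tridiagonal_def GLtL_entries)

text \<open>The hypotheses are \<open>q = L v\<close> and \<open>(t - x) v = G L\<^sup>T q\<close>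
  in coordinates; eliminating \<open>q\<close> gives the claim. Working with entries avoids
  associativity of infinite matrix products.\<close>

lemma GLtL_mat_vec:
  assumes q0: "q 0 = l 0 * v 0" and q: "\<And>n. q (Suc n) = l (Suc n) * v (Suc n) + m n * v n"
    and v: "\<And>n. (t - x) * v n = e n * (l n * q n + m n * q (Suc n))"
  shows "(mat_diag e \<cdot>\<^sub>M (mat_transpose (lower_bidiagonal l m) \<cdot>\<^sub>M lower_bidiagonal l m)
      +\<^sub>M x *\<^sub>M mat_id) \<cdot>\<^sub>V v = (\<lambda>n. t * v n)"
    (is "?A \<cdot>\<^sub>V v = _")
proof
  fix n
  have tv: "t * v n = x * v n + e n * (l n * q n + m n * q (Suc n))"
    using v[of n] by (simp add: algebra_simps)
  show "(?A \<cdot>\<^sub>V v) n = t * v n"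
  proof (cases n)
    case 0
    then show ?thesis
      unfolding tv mat_vec_tridiagonal[OF GLtL_tridiagonal] GLtL_entries
      by (simp add: numeral_2_eq_2 q0 q power2_eq_square algebra_simps)
  next
    case (Suc k)
    have "(\<Sum>j<k. ?A (Suc k) j * v j) = 0"
      by (intro sum.neutral) (auto simp: GLtL_entries)
    then have "(?A \<cdot>\<^sub>V v) n = (\<Sum>j\<in>{k, Suc k, Suc (Suc k)}. ?A (Suc k) j * v j)"
      unfolding mat_vec_tridiagonal[OF GLtL_tridiagonal] Suc by (simp add: numeral_2_eq_2)
    then show ?thesis
      unfolding tv by (simp add: GLtL_entries Suc q power2_eq_square algebra_simps)
  qed
qed

section \<open>Gauss quadrature\<close>

lemma map_poly_of_real_mult:
  fixes p q :: "real poly"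
  shows "map_poly complex_of_real (p * q) = map_poly complex_of_real p * map_poly complex_of_real q"
  by (rule poly_eqI) (simp add: coeff_map_poly coeff_mult)

lemma map_poly_of_real_add:
  fixes p q :: "real poly"
  shows "map_poly complex_of_real (p + q) = map_poly complex_of_real p + map_poly complex_of_real q"
  by (rule poly_eqI) (simp add: coeff_map_poly)

lemma map_poly_of_real_smult:
  "map_poly complex_of_real (smult c p) = smult (of_real c) (map_poly of_real p)"
  by (rule poly_eqI) (simp add: coeff_map_poly)

lemma poly_map_poly_complex_of_real:
  "poly (map_poly complex_of_real p) (of_real t) = of_real (poly p t)"
  by (induction p) (simp_all add: map_poly_pCons)

text \<open>The fundamental theorem of algebra yields a root, which is real by hypothesis. After it
  is split off, simplicity ensures that it is not a root of the quotient, so the count drops by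
  exactly one.\<close>

lemma card_real_simple_roots:
  fixes p :: "real poly"
  assumes "p \<noteq> 0"
    and "\<And>z. poly (map_poly complex_of_real p) z = 0 \<Longrightarrow> z \<in> \<real>"
    and "\<And>t. poly p t = 0 \<Longrightarrow> poly (pderiv p) t \<noteq> 0"
  shows "card {t. poly p t = 0} = degree p"
  using assms
proof (induction "degree p" arbitrary: p)
  case 0
  then obtain c where "p = [:c:]" "c \<noteq> 0"
    by (metis degree_eq_zeroE pCons_0_0)
  then show ?case by simp
next
  case (Suc n)
  have "degree (map_poly complex_of_real p) \<noteq> 0"
    using Suc.hyps by (simp add: degree_map_poly)
  then obtain z where z: "poly (map_poly complex_of_real p) z = 0"
    by (meson fundamental_theorem_of_algebra constant_degree)
  then obtain r where r: "poly p r = 0"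
    using Suc.prems(2) by (metis Reals_cases of_real_eq_0_iff poly_map_poly_complex_of_real)
  then obtain q where p: "p = [:-r, 1:] * q"
    by (metis poly_eq_0_iff_dvd dvdE)
  have "q \<noteq> 0" using Suc.prems(1) p by auto
  then have "degree p = Suc (degree q)"
    by (simp add: p degree_mult_eq del: mult_pCons_left)
  then have degq: "n = degree q"
    using Suc.hyps by simp
  \<comment> \<open>At \<open>r\<close> the derivative of \<open>p\<close> equals \<open>q\<close>,
    and at a root \<open>t\<close> of \<open>q\<close> it equals \<open>t - r\<close> times the
    derivative of \<open>q\<close>; simplicity thus passes to the quotient.\<close>
  have dp: "pderiv p = q + [:-r, 1:] * pderiv q"
    unfolding p pderiv_mult by (simp add: pderiv_pCons)
  have qr: "poly q r \<noteq> 0"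
    using Suc.prems(3)[OF r] by (simp add: dp)
  have "card {t. poly q t = 0} = degree q"
  proof (rule Suc.hyps(1)[OF degq \<open>q \<noteq> 0\<close>])
    show "z \<in> \<real>" if "poly (map_poly complex_of_real q) z = 0" for z
      using that by (intro Suc.prems(2)) (simp add: p map_poly_of_real_mult del: mult_pCons_left)
    show "poly (pderiv q) t \<noteq> 0" if "poly q t = 0" for t
      using that Suc.prems(3)[of t] by (auto simp: dp) (simp add: p)
  qed
  moreover have "{t. poly p t = 0} = insert r {t. poly q t = 0}"
    by (auto simp: p)
  ultimately show ?case
    using qr degq Suc.hyps poly_roots_finite[OF \<open>q \<noteq> 0\<close>] by simp
qed

section \<open>Three-term recurrences and the Christoffel-Darboux formula\<close>

definition three_term ::
  "(nat \<Rightarrow> 'a :: comm_ring_1) \<Rightarrow> (nat \<Rightarrow> 'a) \<Rightarrow> 'a \<Rightarrow> (nat \<Rightarrow> 'a) \<Rightarrow> bool" where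
  "three_term a b z u \<longleftrightarrow> z * u 0 = b 0 * u 0 + a 0 * u (Suc 0) \<and>
    (\<forall>n. z * u (Suc n) = a n * u n + b (Suc n) * u (Suc n) + a (Suc n) * u (Suc (Suc n)))"

text \<open>In each product the diagonal terms in \<open>b\<close> cancel, and the off-diagonal
  terms telescope because the recurrence is symmetric. It holds over any commutative ring, so it
  covers real points as well as a complex point and its conjugate.\<close>

lemma Christoffel_Darboux:
  assumes u: "three_term a b z u" and v: "three_term a b w v"
  shows "(z - w) * (\<Sum>k\<le>n. u k * v k) = a n * (u (Suc n) * v n - u n * v (Suc n))"
proof (induction n)
  case 0
  have "(z - w) * (u 0 * v 0) = (z * u 0) * v 0 - u 0 * (w * v 0)"
    by (simp add: algebra_simps)
  also have "\<dots> = a 0 * (u (Suc 0) * v 0 - u 0 * v (Suc 0))"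
    using u v unfolding three_term_def by (simp add: algebra_simps)
  finally show ?case by simp
next
  case (Suc n)
  have "(z - w) * (u (Suc n) * v (Suc n)) =
      (z * u (Suc n)) * v (Suc n) - u (Suc n) * (w * v (Suc n))"
    by (simp add: algebra_simps)
  also have "z * u (Suc n) = a n * u n + b (Suc n) * u (Suc n) + a (Suc n) * u (Suc (Suc n))"
    using u by (simp add: three_term_def)
  also have "w * v (Suc n) = a n * v n + b (Suc n) * v (Suc n) + a (Suc n) * v (Suc (Suc n))"
    using v by (simp add: three_term_def)
  finally have "(z - w) * (u (Suc n) * v (Suc n)) =
      a n * (u n * v (Suc n) - u (Suc n) * v n)
      + a (Suc n) * (u (Suc (Suc n)) * v (Suc n) - u (Suc n) * v (Suc (Suc n)))"
    by (simp add: algebra_simps)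
  then show ?case
    by (simp add: distrib_left Suc) (simp add: algebra_simps)
qed

fun jacobi_poly :: "(nat \<Rightarrow> real) \<Rightarrow> (nat \<Rightarrow> real) \<Rightarrow> nat \<Rightarrow> real poly" where
  "jacobi_poly a b 0 = 1"
| "jacobi_poly a b (Suc 0) = smult (1 / a 0) [:- b 0, 1:]"
| "jacobi_poly a b (Suc (Suc n)) =
     smult (1 / a (Suc n))
       ([:- b (Suc n), 1:] * jacobi_poly a b (Suc n) - smult (a n) (jacobi_poly a b n))"

text \<open>The off-diagonal entries may have either sign, since they will be
  \<open>\<epsilon> n * l n * m n\<close>.\<close>

locale jacobi =
  fixes a b :: "nat \<Rightarrow> real"
  assumes a_nz: "\<And>n. a n \<noteq> 0"
begin

abbreviation "Q \<equiv> jacobi_poly a b"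

lemma Q_recurrence_0: "[:0, 1:] * Q 0 = smult (b 0) (Q 0) + smult (a 0) (Q (Suc 0))"
  by (simp add: a_nz)

lemma Q_recurrence_Suc:
  "[:0, 1:] * Q (Suc n) =
    smult (a n) (Q n) + smult (b (Suc n)) (Q (Suc n)) + smult (a (Suc n)) (Q (Suc (Suc n)))"
proof -
  have "smult (a (Suc n)) (Q (Suc (Suc n))) = [:- b (Suc n), 1:] * Q (Suc n) - smult (a n) (Q n)"
    by (simp only: jacobi_poly.simps smult_smult) (simp add: a_nz)
  then show ?thesis
    by simp
qed

declare jacobi_poly.simps(2,3) [simp del]

lemma degree_Q: "degree (Q n) = n"
proof (induction n rule: less_induct)
  case (less n)
  consider "n = 0" | "n = 1" | m where "n = Suc (Suc m)"
    by (metis One_nat_def not0_implies_Suc)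
  then show ?case
  proof cases
    case 3
    have "Q (Suc m) \<noteq> 0" "degree (Q m) = m" "degree (Q (Suc m)) = Suc m"
      using less[of "Suc m"] less[of m] 3 by (auto)
    then have "degree ([:- b (Suc m), 1:] * Q (Suc m) + - smult (a m) (Q m)) = Suc (Suc m)"
      by (subst degree_add_eq_left)
        (auto simp: degree_mult_eq simp del: mult_pCons_left
          intro!: le_less_trans[OF degree_smult_le])
    then show ?thesis
      using 3 a_nz by (simp add: jacobi_poly.simps)
  qed (use a_nz in \<open>auto simp: jacobi_poly.simps\<close>)
qed

lemma three_term_real: "three_term a b t (\<lambda>n. poly (Q n) t)"
  using arg_cong[OF Q_recurrence_0, of "\<lambda>p. poly p t"]
    arg_cong[OF Q_recurrence_Suc, of "\<lambda>p. poly p t"]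
  by (simp add: three_term_def)

lemma three_term_complex:
  "three_term (\<lambda>n. of_real (a n)) (\<lambda>n. of_real (b n)) z (\<lambda>n. poly (map_poly complex_of_real (Q n)) z)"
proof -
  have *: "poly (map_poly complex_of_real ([:0, 1:] * p)) z = z * poly (map_poly complex_of_real p) z" for p
    by (subst map_poly_of_real_mult) (simp add: map_poly_pCons)
  show ?thesis
    using arg_cong[OF Q_recurrence_0, of "\<lambda>p. poly (map_poly complex_of_real p) z"]
      arg_cong[OF Q_recurrence_Suc, of "\<lambda>p. poly (map_poly complex_of_real p) z"]
    unfolding three_term_def *
    by (simp add: map_poly_of_real_add map_poly_of_real_smult map_poly_pCons)
qed

text \<open>This is the limiting case of coinciding points, obtained without a limit by
  differentiating the recurrence.\<close>

lemma confluent_Christoffel_Darboux: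
  "(\<Sum>k\<le>n. (poly (Q k) t)\<^sup>2) =
    a n * (poly (pderiv (Q (Suc n))) t * poly (Q n) t - poly (pderiv (Q n)) t * poly (Q (Suc n)) t)"
proof (induction n)
  case (Suc n)
  let ?q = "\<lambda>n. poly (Q n) t" and ?d = "\<lambda>n. poly (pderiv (Q n)) t"
  have 1: "t * ?q (Suc n) = a n * ?q n + b (Suc n) * ?q (Suc n) + a (Suc n) * ?q (Suc (Suc n))"
    using three_term_real by (simp add: three_term_def)
  from arg_cong[OF Q_recurrence_Suc[of n], of "\<lambda>p. poly (pderiv p) t"]
  have 2: "?q (Suc n) + t * ?d (Suc n) = a n * ?d n + b (Suc n) * ?d (Suc n) + a (Suc n) * ?d (Suc (Suc n))"
    by (simp add: pderiv_mult pderiv_add pderiv_smult pderiv_pCons)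
  have "(?q (Suc n))\<^sup>2 = (?q (Suc n) + t * ?d (Suc n)) * ?q (Suc n) - ?d (Suc n) * (t * ?q (Suc n))"
    by (simp add: power2_eq_square algebra_simps)
  also have "\<dots> = a n * (?d n * ?q (Suc n) - ?d (Suc n) * ?q n)
      + a (Suc n) * (?d (Suc (Suc n)) * ?q (Suc n) - ?d (Suc n) * ?q (Suc (Suc n)))"
    unfolding 1 2 by (simp add: algebra_simps)
  finally show ?case
    using Suc by (simp add: algebra_simps)
qed (simp add: pderiv_smult pderiv_pCons a_nz jacobi_poly.simps)

lemma sum_squares_pos: "(\<Sum>k\<le>n. (poly (Q k) t)\<^sup>2) > 0"
proof -
  have "0 < (\<Sum>k\<in>{0}. (poly (Q k) t)\<^sup>2)" by simp
  also have "\<dots> \<le> (\<Sum>k\<le>n. (poly (Q k) t)\<^sup>2)"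
    by (intro sum_mono2) auto
  finally show ?thesis .
qed

text \<open>Apply Christoffel-Darboux at \<open>z\<close> and \<open>cnj z\<close>. The right side
  vanishes at a root, while the sum on the left is a sum of squared moduli whose first term is 1, so
  \<open>z = cnj z\<close>.\<close>

lemma roots_real:
  assumes "poly (map_poly complex_of_real (Q n)) z = 0"
  shows "z \<in> \<real>"
proof (cases n)
  case (Suc m)
  let ?u = "\<lambda>z k. poly (map_poly complex_of_real (Q k)) z"
  have cnj: "?u (cnj z) k = cnj (?u z k)" for k
    by (rule poly_cnj_real[symmetric]) (simp add: coeff_map_poly)
  have "(z - cnj z) * (\<Sum>k\<le>m. ?u z k * ?u (cnj z) k) = 0"
    using Christoffel_Darboux[OF three_term_complex three_term_complex, of z "cnj z" m] assms
    by (simp add: cnj Suc)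
  moreover have "(\<Sum>k\<le>m. ?u z k * ?u (cnj z) k) = of_real (\<Sum>k\<le>m. (cmod (?u z k))\<^sup>2)"
    by (simp add: cnj flip: complex_norm_square)
  moreover have "(\<Sum>k\<le>m. (cmod (?u z k))\<^sup>2) \<noteq> 0"
  proof -
    have "0 < (\<Sum>k\<in>{0}. (cmod (?u z k))\<^sup>2)" by (simp add: map_poly_1')
    also have "\<dots> \<le> (\<Sum>k\<le>m. (cmod (?u z k))\<^sup>2)"
      by (intro sum_mono2) auto
    finally show ?thesis by simp
  qed
  ultimately have "z - cnj z = 0"
    by (simp only: mult_eq_0_iff of_real_eq_0_iff) blast
  then show ?thesis
    by (simp add: Reals_cnj_iff)
qed (use assms in \<open>simp add: map_poly_1'\<close>)

section \<open>Quadrature nodes, weights and discrete measures\<close>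

definition nodes :: "nat \<Rightarrow> real set" where
  "nodes N = {t. poly (Q N) t = 0}"

text \<open>These are the Christoffel numbers, written as reciprocals of the diagonal of the
  reproducing kernel, which makes nonnegativity immediate.\<close>

definition weight :: "nat \<Rightarrow> real \<Rightarrow> real" where
  "weight N t = 1 / (\<Sum>k<N. (poly (Q k) t)\<^sup>2)"

lemma Q_nz: "Q n \<noteq> 0"
  by (metis degree_Q degree_0 jacobi_poly.simps(1) one_neq_zero)

lemma finite_nodes: "finite (nodes N)"
  unfolding nodes_def by (rule poly_roots_finite[OF Q_nz])

text \<open>Roots are simple: at a root the confluent formula equates a positive sum with a multiple
  of the derivative.\<close>

lemma card_nodes: "card (nodes N) = N"
proof -
  have "card (nodes N) = degree (Q N)"
    unfolding nodes_def
  proof (rule card_real_simple_roots[OF Q_nz roots_real])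
    fix t assume t: "poly (Q N) t = 0"
    show "poly (pderiv (Q N)) t \<noteq> 0"
    proof (cases N)
      case (Suc m)
      then show ?thesis
        using confluent_Christoffel_Darboux[of t m] sum_squares_pos[of t m] t by auto
    qed (use t in simp)
  qed
  then show ?thesis by (simp add: degree_Q)
qed

lemma weight_nonneg: "weight N t \<ge> 0"
  by (simp add: weight_def sum_nonneg)

text \<open>By the Christoffel-Darboux formula the reproducing kernel vanishes at pairs of distinct nodes,
  so \<open>\<Sum>s. weight N s * f s * K t s\<close> is the Lagrange interpolation of \<open>f\<close>; comparing coefficients
  for \<open>f = Q k\<close> gives the discrete orthogonality.\<close>

lemma nodes_orthonormal:
  assumes "k < N" "l < N"
  shows "(\<Sum>s\<in>nodes N. weight N s * (poly (Q k) s * poly (Q l) s)) = (if k = l then 1 else 0)"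
proof -
  obtain m where N: "N = Suc m" using assms by (cases N) auto
  define K where "K t s = (\<Sum>k<N. poly (Q k) t * poly (Q k) s)" for t s
  have K0: "K t s = 0" if "t \<in> nodes N" "s \<in> nodes N" "t \<noteq> s" for t s
    using Christoffel_Darboux[OF three_term_real three_term_real, of t s m] that
    by (simp add: K_def nodes_def N lessThan_Suc_atMost)
  have K1: "weight N t * K t t = 1" for t
    using sum_squares_pos[where n = m and t = t]
    by (simp add: K_def weight_def N lessThan_Suc_atMost power2_eq_square)
  define c where "c l = (\<Sum>s\<in>nodes N. weight N s * (poly (Q k) s * poly (Q l) s))" for l
  \<comment> \<open>\<open>D\<close> is \<open>Q k\<close> minus its discrete Fourier expansion. It
    has degree below \<open>N\<close> but vanishes at all \<open>N\<close> nodes, so it is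
    zero.\<close>
  define D where "D = (\<Sum>l<N. smult ((if l = k then 1 else 0) - c l) (Q l))"
  have "D = 0"
  proof (rule ccontr)
    assume "D \<noteq> 0"
    have "degree D \<le> m"
      unfolding D_def
      by (intro degree_sum_le)
        (auto intro!: order_trans[OF degree_smult_le] simp: degree_Q N)
    have "poly D t = 0" if t: "t \<in> nodes N" for t
    proof -
      have "poly D t = poly (Q k) t - (\<Sum>l<N. c l * poly (Q l) t)"
        using assms
        by (simp add: D_def poly_sum left_diff_distrib sum_subtractf if_distrib[of "\<lambda>x. x * _"] cong: if_cong)
      also have "(\<Sum>l<N. c l * poly (Q l) t) = (\<Sum>s\<in>nodes N. weight N s * poly (Q k) s * K t s)"
        unfolding c_def K_def sum_distrib_left sum_distrib_right
        by (subst sum.swap) (simp add: mult_ac)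
      also have "\<dots> = (\<Sum>s\<in>nodes N. if s = t then poly (Q k) t else 0)"
        using t K0 K1[of t] by (intro sum.cong) (auto simp: mult_ac)
      also have "\<dots> = poly (Q k) t"
        using t finite_nodes by simp
      finally show ?thesis by simp
    qed
    then have "nodes N \<subseteq> {t. poly D t = 0}" by auto
    then have "card (nodes N) \<le> card {t. poly D t = 0}"
      using poly_roots_finite[OF \<open>D \<noteq> 0\<close>] by (rule card_mono[rotated])
    also have "\<dots> \<le> degree D"
      using \<open>D \<noteq> 0\<close> by (rule card_poly_roots_bound)
    finally show False
      using \<open>degree D \<le> m\<close> card_nodes[of N] N by simp
  qed
  from degree_basis_independent[OF degree_Q Q_nz this[unfolded D_def] \<open>l < N\<close>]
  show ?thesis by (simp add: c_def split: if_splits)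
qed

text \<open>Expand \<open>p\<close> in the \<open>Q k\<close>. By discrete orthogonality to
  \<open>Q 0 = 1\<close> only the coefficient of \<open>Q 0\<close> survives, and it does not depend
  on \<open>N\<close>.\<close>

lemma nodes_sum_poly_const:
  "\<exists>c. \<forall>N>degree p. (\<Sum>s\<in>nodes N. weight N s * poly p s) = c"
proof -
  obtain c where c: "p = (\<Sum>k<Suc (degree p). smult (c k) (Q k))"
    using degree_basis_span[OF degree_Q Q_nz, of p "Suc (degree p)"] by auto
  have "(\<Sum>s\<in>nodes N. weight N s * poly p s) = c 0" if N: "N > degree p" for N
  proof -
    have "(\<Sum>s\<in>nodes N. weight N s * poly p s) =
        (\<Sum>k<Suc (degree p). c k * (\<Sum>s\<in>nodes N. weight N s * (poly (Q k) s * poly (Q 0) s)))"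
      by (subst (1) c, unfold poly_sum sum_distrib_left, subst sum.swap)
        (simp add: mult_ac del: sum.lessThan_Suc)
    also have "\<dots> = (\<Sum>k<Suc (degree p). c k * (if k = 0 then 1 else 0))"
      using N by (intro sum.cong refl) (subst nodes_orthonormal, auto)
    also have "\<dots> = c 0"
      by (simp add: if_distrib cong: if_cong del: sum.lessThan_Suc)
    finally show ?thesis .
  qed
  then show ?thesis by blast
qed

text \<open>The push-forward moves the point measure from the finite set of nodes to the Borel sets
  of the line, as weak convergence requires.\<close>

definition node_measure :: "nat \<Rightarrow> real measure" where
  "node_measure N = distr (point_measure (nodes N) (\<lambda>t. ennreal (weight N t))) borel (\<lambda>t. t)"

lemma node_measure_integral:
  fixes f :: "real \<Rightarrow> real"
  assumes "f \<in> borel_measurable borel"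
  shows "integrable (node_measure N) f"
    and "integral\<^sup>L (node_measure N) f = (\<Sum>s\<in>nodes N. weight N s * f s)"
proof -
  have [measurable]: "(\<lambda>t. t) \<in> measurable (point_measure (nodes N) (\<lambda>t. ennreal (weight N t))) borel"
    by (simp add: point_measure_def)
  show "integrable (node_measure N) f"
    unfolding node_measure_def using assms
    by (subst integrable_distr_eq) (auto intro!: integrable_point_measure_finite finite_nodes)
  show "integral\<^sup>L (node_measure N) f = (\<Sum>s\<in>nodes N. weight N s * f s)"
    unfolding node_measure_def using assms
    by (subst integral_distr)
      (auto simp: lebesgue_integral_point_measure_finite finite_nodes weight_nonneg)
qed

lemma node_measure_prob:
  assumes "N > 0"
  shows "real_distribution (node_measure N)"
proof -
  have m: "(\<lambda>t. t) \<in> measurable (point_measure (nodes N) (\<lambda>t. ennreal (weight N t))) borel"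
    by (simp add: point_measure_def)
  have "emeasure (point_measure (nodes N) (\<lambda>t. ennreal (weight N t))) (nodes N) =
      ennreal (\<Sum>s\<in>nodes N. weight N s)"
    by (simp add: emeasure_point_measure_finite finite_nodes weight_nonneg)
  also have "(\<Sum>s\<in>nodes N. weight N s) = 1"
    using nodes_orthonormal[of 0 N 0] assms by simp
  finally have "prob_space (point_measure (nodes N) (\<lambda>t. ennreal (weight N t)))"
    by (intro prob_spaceI) (simp add: space_point_measure)
  then have "prob_space (node_measure N)"
    unfolding node_measure_def by (rule prob_space.prob_space_distr[OF _ m])
  then show ?thesis
    by (simp add: real_distribution_def real_distribution_axioms_def node_measure_def)
qed

end

section \<open>Convergence of moments\<close>

text \<open>Powers of the clamped variable are bounded and continuous, hence admissible test
  functions for weak convergence, unlike the powers themselves.\<close>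

definition clamp_real :: "real \<Rightarrow> real \<Rightarrow> real" where
  "clamp_real R t = max (- R) (min R t)"

lemma clamp_real_continuous: "continuous_on UNIV (\<lambda>t. clamp_real R t ^ k)"
  unfolding clamp_real_def by (intro continuous_intros)

lemma clamp_real_measurable [measurable]: "(\<lambda>t. clamp_real R t ^ k) \<in> borel_measurable borel"
  using clamp_real_continuous by (rule borel_measurable_continuous_onI)

lemma abs_clamp_real: "R \<ge> 0 \<Longrightarrow> \<bar>clamp_real R t\<bar> = min R \<bar>t\<bar>"
  by (auto simp: clamp_real_def min_def max_def)

lemma clamp_real_power_bound: "R \<ge> 0 \<Longrightarrow> \<bar>clamp_real R t ^ k\<bar> \<le> R ^ k"
  unfolding power_abs by (intro power_mono) (simp_all add: abs_clamp_real)

lemma clamp_real_even_power: "R \<ge> 0 \<Longrightarrow> clamp_real R t ^ (2 * k) = min R \<bar>t\<bar> ^ (2 * k)"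
  by (metis abs_clamp_real power_even_abs even_mult_iff even_numeral)

text \<open>The error lives where \<open>\<bar>t\<bar> > R \<ge> 1\<close>, and there raising the
  exponent and inserting the factor \<open>\<bar>t\<bar> / R\<close> only increases the bound. A
  higher even moment thus controls the tail at rate \<open>1 / R\<close>.\<close>

lemma clamp_real_power_error:
  assumes "R \<ge> 1"
  shows "\<bar>t ^ k - clamp_real R t ^ k\<bar> \<le> 2 / R * t ^ (2 * (k + 1))"
proof (cases "\<bar>t\<bar> \<le> R")
  case True
  then have "clamp_real R t = t"
    by (auto simp: clamp_real_def)
  moreover have "0 \<le> 2 / R * t ^ (2 * (k + 1))"
    using assms by (intro mult_nonneg_nonneg zero_le_even_power) auto
  ultimately show ?thesis
    by simp
next
  case False
  have "\<bar>t ^ k - clamp_real R t ^ k\<bar> \<le> \<bar>t\<bar> ^ k + R ^ k"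
    using clamp_real_power_bound[of R t k] assms by (simp add: power_abs[symmetric])
  also have "\<dots> \<le> 2 * \<bar>t\<bar> ^ k"
    using False assms power_mono[of R "\<bar>t\<bar>" k] by simp
  also have "\<dots> \<le> 2 * \<bar>t\<bar> ^ (2 * k + 1) * 1"
    unfolding mult_1_right using False assms by (intro mult_left_mono power_increasing) auto
  also have "2 * \<bar>t\<bar> ^ (2 * k + 1) * 1 \<le> 2 * \<bar>t\<bar> ^ (2 * k + 1) * (\<bar>t\<bar> / R)"
    using False assms by (intro mult_left_mono) auto
  also have "\<dots> = 2 / R * \<bar>t\<bar> ^ (2 * k + 2)"
    by (simp only: add_2_eq_Suc' Suc_eq_plus1[symmetric] power_Suc times_divide_eq_left
        times_divide_eq_right mult_ac)
  also have "2 * k + 2 = 2 * (k + 1)"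
    by simp
  also have "\<bar>t\<bar> ^ (2 * (k + 1)) = t ^ (2 * (k + 1))"
    by (rule power_even_abs) simp
  finally show ?thesis .
qed

text \<open>Weak convergence handles the clamped powers. The clamping error is bounded by a
  convergent higher moment divided by \<open>R\<close>, uniformly in \<open>n\<close>, so
  \<open>R\<close> can be sent to infinity.\<close>

lemma weak_limit_moments:
  fixes \<mu> :: "nat \<Rightarrow> real measure" and c :: "nat \<Rightarrow> real"
  assumes \<mu>: "\<And>n. real_distribution (\<mu> n)" and M: "real_distribution M"
    and conv: "weak_conv_m \<mu> M"
    and int: "\<And>n k. integrable (\<mu> n) (\<lambda>t. t ^ k)"
    and lim: "\<And>k. (\<lambda>n. LINT t|\<mu> n. t ^ k) \<longlonglongrightarrow> c k"
  shows "integrable M (\<lambda>t. t ^ k)" and "(LINT t|M. t ^ k) = c k"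
proof -
  interpret M: real_distribution M by (rule M)
  have clamp_int: "integrable N (\<lambda>t. clamp_real R t ^ k)" if "real_distribution N" "R \<ge> 0" for N R k
  proof -
    interpret N: real_distribution N by (rule that)
    show ?thesis
      using clamp_real_power_bound[OF that(2)] by (intro N.integrable_const_bound[of _ "R ^ k"]) auto
  qed
  have clamp_lim: "(\<lambda>n. LINT t|\<mu> n. clamp_real R t ^ k) \<longlonglongrightarrow> (LINT t|M. clamp_real R t ^ k)"
    if "R \<ge> 0" for R k
    using clamp_real_power_bound[OF that] clamp_real_continuous[of R k]
    by (intro weak_conv_imp_integral_bdd_continuous_conv[OF \<mu> M conv, of _ "R ^ k"])
      (auto simp: continuous_on_eq_continuous_at)
  have even_le: "(LINT t|M. clamp_real R t ^ (2 * k)) \<le> c (2 * k)" if "R \<ge> 0" for R k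
  proof (rule LIMSEQ_le[OF clamp_lim[OF that] lim], intro exI[of _ 0] allI impI)
    fix n
    show "(LINT t|\<mu> n. clamp_real R t ^ (2 * k)) \<le> (LINT t|\<mu> n. t ^ (2 * k))"
    proof (rule integral_mono[OF clamp_int[OF \<mu> that] int])
      fix t
      have "min R \<bar>t\<bar> ^ (2 * k) \<le> \<bar>t\<bar> ^ (2 * k)"
        using that by (intro power_mono) auto
      then show "clamp_real R t ^ (2 * k) \<le> t ^ (2 * k)"
        using that by (simp add: clamp_real_even_power power_even_abs)
    qed
  qed
  \<comment> \<open>Clamped even powers increase with the clamping level and their integrals are
    bounded by \<open>even_le\<close>, so monotone convergence applies.\<close>
  have even: "integrable M (\<lambda>t. t ^ (2 * k)) \<and> (LINT t|M. t ^ (2 * k)) \<le> c (2 * k)" for k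
  proof -
    define I where "I i = (LINT t|M. clamp_real (real i) t ^ (2 * k))" for i :: nat
    have mono: "clamp_real (real i) t ^ (2 * k) \<le> clamp_real (real j) t ^ (2 * k)" if "i \<le> j" for i j t
      unfolding clamp_real_even_power[OF of_nat_0_le_iff] using that by (intro power_mono) auto
    have "incseq I"
      unfolding I_def incseq_def using mono
      by (intro allI impI integral_mono clamp_int M.real_distribution_axioms M) auto
    then obtain L where L: "I \<longlonglongrightarrow> L"
      by (rule incseq_convergent[of I "c (2 * k)"]) (auto simp: I_def even_le)
    have ptw: "(\<lambda>i. clamp_real (real i) t ^ (2 * k)) \<longlonglongrightarrow> t ^ (2 * k)" for t
    proof (rule tendsto_eventually)
      show "\<forall>\<^sub>F i in sequentially. clamp_real (real i) t ^ (2 * k) = t ^ (2 * k)"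
        using eventually_ge_at_top[of "nat \<lceil>\<bar>t\<bar>\<rceil>"]
      proof eventually_elim
        case (elim i)
        then have "\<bar>t\<bar> \<le> real i" by linarith
        then show ?case by (simp add: clamp_real_def abs_le_iff)
      qed
    qed
    have *: "integrable M (\<lambda>t. clamp_real (real i) t ^ (2 * k))" for i
      by (rule clamp_int[OF M]) simp
    have "integrable M (\<lambda>t. t ^ (2 * k))"
      using mono ptw L unfolding I_def
      by (intro integrable_monotone_convergence[OF *]) (auto simp: mono_def)
    moreover have "(LINT t|M. t ^ (2 * k)) = L"
      using mono ptw L unfolding I_def
      by (intro integral_monotone_convergence[OF *]) (auto simp: mono_def)
    moreover have "L \<le> c (2 * k)"
      by (rule LIMSEQ_le_const2[OF L]) (auto simp: I_def even_le)
    ultimately show ?thesis by simp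
  qed
  show intM: "integrable M (\<lambda>t. t ^ k)" for k
  proof (rule Bochner_Integration.integrable_bound)
    show "integrable M (\<lambda>t. 1 + t ^ (2 * k))"
      using even by auto
    have "\<bar>t\<bar> ^ k \<le> 1 + (\<bar>t\<bar> ^ k)\<^sup>2" for t :: real
      using sum_power2_ge_zero[of "\<bar>t\<bar> ^ k - 1" "\<bar>t\<bar> ^ k"] by (simp add: power2_eq_square algebra_simps)
    moreover have "t ^ (2 * k) = (\<bar>t\<bar> ^ k)\<^sup>2" for t :: real
      unfolding power_even_eq power_abs[of t k, symmetric] power2_abs ..
    ultimately have "\<bar>t ^ k\<bar> \<le> \<bar>1 + t ^ (2 * k)\<bar>" for t :: real
      by (simp add: power_abs)
    then show "AE t in M. norm (t ^ k) \<le> norm (1 + t ^ (2 * k))"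
      by auto
  qed auto
  define C where "C = c (2 * (k + 1))"
  have err: "\<bar>(LINT t|N. t ^ k) - (LINT t|N. clamp_real R t ^ k)\<bar>
      \<le> 2 / R * (LINT t|N. t ^ (2 * (k + 1)))"
    if N: "real_distribution N" "\<And>k. integrable N (\<lambda>t. t ^ k)" and R: "R \<ge> 1" for N R
  proof -
    have i: "integrable N (\<lambda>t. clamp_real R t ^ k)"
      using R by (intro clamp_int N) simp
    have "\<bar>(LINT t|N. t ^ k) - (LINT t|N. clamp_real R t ^ k)\<bar>
        = \<bar>LINT t|N. t ^ k - clamp_real R t ^ k\<bar>"
      using N i by (subst Bochner_Integration.integral_diff) auto
    also have "\<dots> \<le> (LINT t|N. \<bar>t ^ k - clamp_real R t ^ k\<bar>)"
      by (rule integral_abs_bound)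
    also have "\<dots> \<le> (LINT t|N. 2 / R * t ^ (2 * (k + 1)))"
      using N(2)[of k] N(2)[of "2 * (k + 1)"] i clamp_real_power_error[OF R, of _ k]
      by (intro integral_mono integrable_abs Bochner_Integration.integrable_diff
          Bochner_Integration.integrable_mult_right) auto
    finally show ?thesis by simp
  qed
  \<comment> \<open>Both numbers lie within \<open>2 * C / R\<close> of the clamped moment of
    \<open>M\<close>.\<close>
  have bound: "\<bar>(LINT t|M. t ^ k) - c k\<bar> \<le> 4 * C / R" if R: "R \<ge> 1" for R
  proof -
    have "(\<lambda>n. \<bar>(LINT t|\<mu> n. t ^ k) - (LINT t|\<mu> n. clamp_real R t ^ k)\<bar>)
        \<longlonglongrightarrow> \<bar>c k - (LINT t|M. clamp_real R t ^ k)\<bar>"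
      using R by (intro tendsto_intros lim clamp_lim) auto
    moreover have "(\<lambda>n. 2 / R * (LINT t|\<mu> n. t ^ (2 * (k + 1)))) \<longlonglongrightarrow> 2 / R * C"
      unfolding C_def by (intro tendsto_intros lim)
    ultimately have "\<bar>c k - (LINT t|M. clamp_real R t ^ k)\<bar> \<le> 2 / R * C"
      using err[OF \<mu> int R] by (intro LIMSEQ_le) auto
    moreover have "\<bar>(LINT t|M. t ^ k) - (LINT t|M. clamp_real R t ^ k)\<bar> \<le> 2 / R * C"
    proof (rule order_trans[OF err[OF M intM R]])
      show "2 / R * (LINT t|M. t ^ (2 * (k + 1))) \<le> 2 / R * C"
        unfolding C_def using even[of "k + 1"] R by (intro mult_left_mono) auto
    qed
    ultimately show ?thesis
      by (simp add: abs_le_iff)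
  qed
  have "((\<lambda>R. 4 * C / R) \<longlongrightarrow> 0) at_top"
    by (intro tendsto_divide_0[OF tendsto_const] filterlim_at_top_imp_at_infinity filterlim_ident)
  then have "\<bar>(LINT t|M. t ^ k) - c k\<bar> \<le> 0"
    by (rule tendsto_lowerbound) (use bound in \<open>auto intro!: eventually_at_top_linorderI[of 1]\<close>)
  then show "(LINT t|M. t ^ k) = c k" by simp
qed

lemma tight_if_second_moments_bounded:
  fixes \<mu> :: "nat \<Rightarrow> real measure"
  assumes \<mu>: "\<And>n. real_distribution (\<mu> n)"
    and int: "\<And>n. integrable (\<mu> n) (\<lambda>t. t\<^sup>2)"
    and bound: "\<And>n. (LINT t|\<mu> n. t\<^sup>2) \<le> C"
  shows "tight \<mu>"
  unfolding tight_def
proof (intro conjI allI impI \<mu>)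
  fix \<epsilon> :: real assume "\<epsilon> > 0"
  \<comment> \<open>Markov's inequality gives \<open>C / R\<^sup>2\<close>, which is at most
    \<open>C / R\<close> because \<open>R \<ge> 1\<close>; the other summand makes
    \<open>C / R\<close> smaller than \<open>\<epsilon>\<close>.\<close>
  define R where "R = 1 + max 0 (C / \<epsilon>)"
  have R: "R \<ge> 1" "C / R < \<epsilon>"
    using \<open>\<epsilon> > 0\<close> by (auto simp: R_def field_simps max_def)
  have "1 - \<epsilon> < measure (\<mu> n) {-R<..R}" for n
  proof -
    interpret real_distribution "\<mu> n" by (rule \<mu>)
    have "measure (\<mu> n) {t\<in>space (\<mu> n). t\<^sup>2 \<ge> R\<^sup>2} \<le> (LINT t|\<mu> n. t\<^sup>2) / R\<^sup>2"
      using R by (intro integral_Markov_inequality_measure[where A = "{}"] int) auto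
    also have "\<dots> \<le> C / R\<^sup>2"
      using bound by (simp add: divide_right_mono)
    also have "\<dots> \<le> C / R"
    proof -
      have "0 \<le> C"
        by (rule order_trans[OF _ bound]) simp
      then show ?thesis
        using R by (intro divide_left_mono) (auto simp: power2_eq_square)
    qed
    finally have "measure (\<mu> n) {t\<in>space (\<mu> n). t\<^sup>2 \<ge> R\<^sup>2} < \<epsilon>"
      using R by simp
    moreover have "1 - measure (\<mu> n) {t\<in>space (\<mu> n). t\<^sup>2 \<ge> R\<^sup>2} \<le> measure (\<mu> n) {-R<..R}"
    proof (subst prob_compl[symmetric])
      have "{t\<in>space (\<mu> n). t\<^sup>2 \<ge> R\<^sup>2} \<in> sets (\<mu> n)" by measurable
      then show "{t\<in>space (\<mu> n). t\<^sup>2 \<ge> R\<^sup>2} \<in> events" .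
      have "R\<^sup>2 \<le> t\<^sup>2" if "t \<notin> {-R<..R}" for t
        using that R abs_le_square_iff[of R t] by auto
      then show "prob (space (\<mu> n) - {t\<in>space (\<mu> n). t\<^sup>2 \<ge> R\<^sup>2}) \<le> prob {-R<..R}"
        by (intro finite_measure_mono) (blast, simp)
    qed
    ultimately show ?thesis by linarith
  qed
  then show "\<exists>a b. a < b \<and> (\<forall>n. 1 - \<epsilon> < measure (\<mu> n) {a<..b})"
    using R by (intro exI[of _ "-R"] exI[of _ R]) auto
qed

section \<open>Favard's theorem\<close>

lemma integrable_poly:
  assumes M: "positive_measure M"
  shows "integrable M (poly p)"
proof -
  have "integrable M (\<lambda>t. \<Sum>i\<le>degree p. coeff p i * t ^ i)"
    using M by (intro Bochner_Integration.integrable_sum integrable_mult_right)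
      (simp add: positive_measure_def)
  then show ?thesis
    by (simp flip: poly_altdef)
qed

lemma integral_poly:
  assumes "positive_measure M"
  shows "integral\<^sup>L M (poly p) = (\<Sum>i\<le>degree p. coeff p i * (LINT t|M. t ^ i))"
proof -
  have "integral\<^sup>L M (poly p) = (LINT t|M. (\<Sum>i\<le>degree p. coeff p i * t ^ i))"
    by (simp flip: poly_altdef)
  also have "\<dots> = (\<Sum>i\<le>degree p. coeff p i * (LINT t|M. t ^ i))"
    using assms by (subst Bochner_Integration.integral_sum) (auto simp: positive_measure_def)
  finally show ?thesis .
qed

lemma poly_borel_measurable: "poly p \<in> borel_measurable (borel :: real measure)"
  by (intro borel_measurable_continuous_onI continuous_intros)

lemma (in jacobi) Favard:
  "\<exists>M. positive_measure M \<and>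
    (\<forall>i j. integral\<^sup>L M (poly (Q i * Q j)) = (if i = j then 1 else 0))"
proof -
  \<comment> \<open>With at least three nodes the second moment already has its final value for
    every \<open>n\<close>, which gives tightness of the whole sequence.\<close>
  define \<mu> where "\<mu> n = node_measure (n + 3)" for n
  have \<mu>: "real_distribution (\<mu> n)" for n
    unfolding \<mu>_def by (rule node_measure_prob) simp
  have \<mu>_poly: "integrable (\<mu> n) (poly p)"
      "integral\<^sup>L (\<mu> n) (poly p) = (\<Sum>s\<in>nodes (n + 3). weight (n + 3) s * poly p s)" for n p
    unfolding \<mu>_def by (auto intro: node_measure_integral poly_borel_measurable)
  have pos\<mu>: "positive_measure (\<mu> n)" for n
    using \<mu>_poly(1)[of n "monom 1 k" for k]
    by (simp add: positive_measure_def \<mu>_def node_measure_def poly_monom[abs_def])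
  have "\<exists>c. \<forall>n. n + 3 > k \<longrightarrow> (LINT t|\<mu> n. t ^ k) = c" for k
  proof -
    obtain c where "\<And>N. N > k \<Longrightarrow> (\<Sum>s\<in>nodes N. weight N s * s ^ k) = c"
      using nodes_sum_poly_const[of "monom 1 k"] by (auto simp: degree_monom_eq poly_monom)
    then show ?thesis
      using \<mu>_poly(2)[of _ "monom 1 k"] by (intro exI[of _ c]) (simp add: poly_monom[abs_def])
  qed
  then obtain c where c: "\<And>k n. n + 3 > k \<Longrightarrow> (LINT t|\<mu> n. t ^ k) = c k"
    by metis
  have int: "integrable (\<mu> n) (\<lambda>t. t ^ k)" for n k
    using pos\<mu> by (simp add: positive_measure_def)
  have lim: "(\<lambda>n. LINT t|\<mu> n. t ^ k) \<longlonglongrightarrow> c k" for k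
    using c[of k] by (intro tendsto_eventually eventually_sequentiallyI[of k]) auto
  have "tight \<mu>"
    using c[of 2] by (intro tight_if_second_moments_bounded[where C = "c 2", OF \<mu> int]) auto
  then obtain r M where r: "strict_mono r" and M: "real_distribution M"
      and conv: "weak_conv_m (\<mu> \<circ> id \<circ> r) M"
    using tight_imp_convergent_subsubsequence[of \<mu> id] by (auto simp: strict_mono_id)
  have lim': "(\<lambda>n. LINT t|\<mu> (r n). t ^ k) \<longlonglongrightarrow> c k" for k
    using LIMSEQ_subseq_LIMSEQ[OF lim r] by (simp add: o_def)
  have moments: "integrable M (\<lambda>t. t ^ k)" "(LINT t|M. t ^ k) = c k" for k
    using weak_limit_moments[where \<mu> = "\<lambda>n. \<mu> (r n)", OF \<mu> M _ int lim'] conv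
    by (simp_all add: o_def)
  have pos: "positive_measure M"
    using moments(1) M by (simp add: positive_measure_def real_distribution.events_eq_borel)
  have "integral\<^sup>L M (poly (Q i * Q j)) = (if i = j then 1 else 0)" for i j
  proof -
    \<comment> \<open>The moments of \<open>M\<close> up to degree \<open>i + j\<close> agree with
      those of this quadrature measure, for which discrete orthogonality is known.\<close>
    define n where "n = i + j"
    have "integral\<^sup>L M (poly (Q i * Q j)) = integral\<^sup>L (\<mu> n) (poly (Q i * Q j))"
      unfolding integral_poly[OF pos] integral_poly[OF pos\<mu>]
    proof (intro sum.cong refl)
      fix k assume "k \<in> {..degree (Q i * Q j)}"
      then have "n + 3 > k"
        using degree_mult_le[of "Q i" "Q j"] by (simp add: degree_Q n_def)
      then show "coeff (Q i * Q j) k * (LINT t|M. t ^ k) = coeff (Q i * Q j) k * (LINT t|\<mu> n. t ^ k)"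
        by (simp add: moments c)
    qed
    also have "\<dots> = (if i = j then 1 else 0)"
      unfolding \<mu>_poly(2) using nodes_orthonormal[of i "n + 3" j] by (simp add: n_def)
    finally show ?thesis .
  qed
  with pos show ?thesis by blast
qed

section \<open>The Christoffel transformation\<close>

lemma poly_functional_integral:
  assumes "positive_measure M"
  shows "poly_functional (\<lambda>p. integral\<^sup>L M (poly (w * p)))"
  by standard
    (simp_all add: distrib_left poly_add[abs_def] poly_smult[abs_def] integrable_poly[OF assms]
      flip: poly_mult del: poly_mult)

text \<open>The truncated densities are the positive and negative parts of \<open>t - x\<close>.
  Both are dominated by its absolute value, so the two integrals exist and recombine into
  one.\<close>

lemma signed_density_linear:
  assumes M: "positive_measure M"
  shows "is_signed_measure (signed_density M (\<lambda>t. t - x))"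
    and "signed_integral (signed_density M (\<lambda>t. t - x)) (poly p) =
      integral\<^sup>L M (poly ([:- x, 1:] * p))"
proof -
  have sets: "sets M = sets borel"
    using M by (simp add: positive_measure_def)
  have [measurable]: "poly q \<in> borel_measurable M" for q
    using poly_borel_measurable by (simp add: measurable_cong_sets[OF sets refl])
  have id [measurable]: "(\<lambda>t. t) \<in> borel_measurable M"
    by (simp add: measurable_cong_sets[OF sets refl])
  have ennreal_max: "ennreal u = ennreal (max 0 u)" for u
    by (auto simp: max_def ennreal_neg)
  \<comment> \<open>The sign \<open>s\<close> treats the positive and the negative part at
    once.\<close>
  have int: "integrable M (\<lambda>t. max 0 (s * (t - x)) * poly q t)" if "s \<in> {1, -1}" for s q
  proof (rule Bochner_Integration.integrable_bound[OF integrable_poly[OF M, of "[:- x, 1:] * q"]])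
    show "AE t in M. norm (max 0 (s * (t - x)) * poly q t) \<le> norm (poly ([:- x, 1:] * q) t)"
      using that by (intro AE_I2) (auto simp: abs_mult simp flip: left_diff_distrib
          intro!: mult_right_mono)
  qed measurable
  have dens: "integrable (density M (\<lambda>t. ennreal (s * (t - x)))) (poly q)"
      "integral\<^sup>L (density M (\<lambda>t. ennreal (s * (t - x)))) (poly q) =
        (LINT t|M. max 0 (s * (t - x)) * poly q t)" if "s \<in> {1, -1}" for s q
    using int[OF that, of q] by (subst ennreal_max, subst integrable_density integral_density; simp)+
  have pm: "positive_measure (density M (\<lambda>t. ennreal (s * (t - x))))" if "s \<in> {1, -1}" for s
    using dens(1)[OF that, of "monom 1 k" for k] sets
    by (simp add: positive_measure_def poly_monom[abs_def])
  show "is_signed_measure (signed_density M (\<lambda>t. t - x))"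
    using pm[of 1] pm[of "-1"] by (simp add: is_signed_measure_def signed_density_def)
  have "signed_integral (signed_density M (\<lambda>t. t - x)) (poly p) =
      (LINT t|M. max 0 (1 * (t - x)) * poly p t) - (LINT t|M. max 0 (- 1 * (t - x)) * poly p t)"
    using dens(2)[of 1 p] dens(2)[of "-1" p] by (simp add: signed_integral_def signed_density_def)
  also have "\<dots> = (LINT t|M. max 0 (1 * (t - x)) * poly p t - max 0 (- 1 * (t - x)) * poly p t)"
    by (rule Bochner_Integration.integral_diff[symmetric]) (rule int, simp)+
  also have "\<dots> = integral\<^sup>L M (poly ([:- x, 1:] * p))"
    by (intro Bochner_Integration.integral_cong) (auto simp: max_def algebra_simps)
  finally show "signed_integral (signed_density M (\<lambda>t. t - x)) (poly p) = \<dots>" .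
qed

section \<open>From the measure to the factorization\<close>

lemma corresponding_matrix:
  fixes P :: "nat \<Rightarrow> real poly"
  assumes \<epsilon>: "\<And>j. \<epsilon> j \<in> {1, -1}" and J: "tridiagonal J" and M: "positive_measure M"
    and deg: "\<And>n. degree (P n) = n"
    and orth: "\<And>n m. integral\<^sup>L M (poly ([:- x, 1:] * (P n * P m))) = (if n = m then \<epsilon> n else 0)"
    and JP: "\<And>t. J \<cdot>\<^sub>V (\<lambda>n. poly (P n) t) = (\<lambda>n. t * poly (P n) t)"
  shows "\<exists>l m. (\<forall>j. l j > 0) \<and> (\<forall>j. m j \<noteq> 0) \<and>
       J = mat_diag \<epsilon> \<cdot>\<^sub>M (mat_transpose (lower_bidiagonal l m) \<cdot>\<^sub>M lower_bidiagonal l m)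
             +\<^sub>M x *\<^sub>M mat_id"
proof -
  define w where "w = [:- x, 1:]"
  define I where "I p = integral\<^sup>L M (poly p)" for p
  define W where "W p = I (w * p)" for p
  interpret I: poly_functional I
    using poly_functional_integral[OF M, of 1] by (simp add: I_def[abs_def])
  interpret W: poly_functional W
    using poly_functional_integral[OF M, of w] by (simp add: W_def[abs_def] I_def[abs_def])
  have \<epsilon>\<epsilon>: "\<epsilon> n * \<epsilon> n = 1" "\<epsilon> n \<noteq> 0" for n
    using \<epsilon>[of n] by auto
  have orthW: "W (P i * P j) = (if i = j then \<epsilon> i else 0)" for i j
    using orth by (simp add: W_def I_def w_def)
  have P0: "P 0 \<noteq> 0"
    using orthW[of 0 0] \<epsilon>\<epsilon>(2)[of 0] by auto
  have Pnz: "P n \<noteq> 0" for n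
    using orthW[of n n] \<epsilon>\<epsilon>(2)[of n] by auto
  have lcP: "coeff (P n) n \<noteq> 0" for n
    using Pnz[of n] deg[of n] by (metis leading_coeff_0_iff)
  \<comment> \<open>A positive measure may have finite support, so this needs an argument: if
    \<open>p\<close> vanished almost everywhere, its product with \<open>P (degree p)\<close> would
    have \<open>W\<close>-value zero, contradicting the nondegeneracy of \<open>W\<close>.\<close>
  have pos: "I (p * p) > 0" if "p \<noteq> 0" for p
  proof (rule ccontr)
    assume "\<not> I (p * p) > 0"
    moreover have "I (p * p) \<ge> 0"
      by (simp add: I_def)
    ultimately have "I (p * p) = 0" by simp
    then have "AE t in M. poly (p * p) t = 0"
      using integral_nonneg_eq_0_iff_AE[OF integrable_poly[OF M], of "p * p"] by (simp add: I_def)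
    then have "I (w * (P (degree p) * p)) = 0"
      unfolding I_def by (intro integral_eq_zero_AE) auto
    then have "coeff p (degree p) * \<epsilon> (degree p) = 0"
      using W.orthogonal_lead_coeff[OF deg P0, of p "degree p"] orthW
      by (auto simp: W_def)
    then show False
      using \<epsilon>\<epsilon>(2) that by simp
  qed
  have sgnP: "sgn (coeff (P n) n) \<in> {1, -1}" for n
    using lcP[of n] by (auto simp: sgn_if)
  obtain Q where degQ: "\<And>n. degree (Q n) = n"
      and lcQ: "\<And>n. sgn (coeff (P n) n) * coeff (Q n) n > 0"
      and orthQ: "\<And>i j. I (Q i * Q j) = (if i = j then 1 else 0)"
    using I.exists_orthonormal[where c = "\<lambda>n. sgn (coeff (P n) n)", OF pos sgnP] by blast
  have Q0: "Q 0 \<noteq> 0"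
    using orthQ[of 0 0] by auto
  have lcQnz: "coeff (Q n) n \<noteq> 0" for n
    using lcQ[of n] by auto
  \<comment> \<open>Both sequences are forced by comparing leading coefficients in
    \<open>q = L p\<close> and \<open>(t - x) p = G L\<^sup>T q\<close>.\<close>
  define l where "l n = coeff (Q n) n / coeff (P n) n" for n
  define m where "m n = \<epsilon> n * coeff (P n) n / coeff (Q (Suc n)) (Suc n)" for n
  have l: "l n > 0" for n
    using lcQ[of n] by (auto simp: l_def sgn_if zero_less_divide_iff split: if_splits)
  have m: "m n \<noteq> 0" for n
    using lcP lcQnz \<epsilon>\<epsilon> by (simp add: m_def)
  have low: "W (P i * Q j) = (if j = i then \<epsilon> i * l i else 0)" if "j \<le> i" for i j
    using W.orthogonal_lead_coeff[OF deg P0, of "Q j" i] orthW that degQ[of j] lcP[of i]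
    by (auto simp: l_def coeff_eq_0 field_simps)
  \<comment> \<open>The same number is now read as the \<open>I\<close>-product of
    \<open>Q j\<close> with \<open>w * P i\<close>, which has degree \<open>i + 1\<close>. Together
    with \<open>low\<close>, the mixed products form the bidiagonal matrix
    \<open>G L\<^sup>T\<close>, which governs both expansions.\<close>
  have high: "W (P i * Q j) = (if j = Suc i then \<epsilon> i * m i else 0)" if "i < j" for i j
  proof -
    have dw: "degree (w * P i) = Suc i"
      using Pnz[of i] deg[of i] by (subst degree_mult_eq) (auto simp: w_def)
    have "coeff (w * P i) (Suc i) = coeff (P i) i"
      by (simp add: w_def coeff_eq_0 deg)
    then have "coeff (w * P i) j = (if j = Suc i then coeff (P i) i else 0)"
      using that dw by (auto intro: coeff_eq_0)
    then have "W (P i * Q j) * coeff (Q j) j = (if j = Suc i then coeff (P i) i else 0)"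
      using I.orthogonal_lead_coeff[OF degQ Q0, of "w * P i" j] orthQ dw that
      by (simp add: W_def mult_ac)
    then show ?thesis
      using lcQnz[of j] \<epsilon>\<epsilon>(1)[of i] by (auto simp: m_def field_simps mult.assoc[symmetric])
  qed
  have WPQ: "W (P i * Q j) = (if j = i then \<epsilon> i * l i else if j = Suc i then \<epsilon> i * m i else 0)" for i j
    using low[of j i] high[of i j] by (cases "j \<le> i") auto
  have Q_0: "Q 0 = smult (l 0) (P 0)"
    by (rule W.eq_if_products_eq[OF deg P0])
      (auto simp: orthW WPQ \<epsilon>\<epsilon> W.smult)
  have Q_Suc: "Q (Suc n) = smult (l (Suc n)) (P (Suc n)) + smult (m n) (P n)" for n
    by (rule W.eq_if_products_eq[OF deg P0])
      (auto simp: orthW WPQ \<epsilon>\<epsilon> W.smult W.add distrib_left)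
  have wP: "w * P n = smult (\<epsilon> n) (smult (l n) (Q n) + smult (m n) (Q (Suc n)))" for n
  proof (rule I.eq_if_products_eq[OF degQ Q0])
    fix k
    have "I (Q k * (w * P n)) = W (P n * Q k)"
      by (simp add: W_def mult_ac)
    then show "I (Q k * (w * P n)) =
        I (Q k * smult (\<epsilon> n) (smult (l n) (Q n) + smult (m n) (Q (Suc n))))"
      by (auto simp: WPQ orthQ I.smult I.add distrib_left smult_add_right)
  qed (simp_all add: orthQ)
  have "J = mat_diag \<epsilon> \<cdot>\<^sub>M (mat_transpose (lower_bidiagonal l m) \<cdot>\<^sub>M lower_bidiagonal l m)
             +\<^sub>M x *\<^sub>M mat_id"
  proof (rule tridiagonal_eqI[OF J GLtL_tridiagonal deg P0])
    fix t
    have "(t - x) * poly (P n) t = \<epsilon> n * (l n * poly (Q n) t + m n * poly (Q (Suc n)) t)" for n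
      using arg_cong[OF wP[of n], of "\<lambda>p. poly p t"] by (simp add: w_def algebra_simps)
    from GLtL_mat_vec[of "\<lambda>n. poly (Q n) t" l "\<lambda>n. poly (P n) t" m, OF _ _ this]
    show "J \<cdot>\<^sub>V (\<lambda>n. poly (P n) t) = (mat_diag \<epsilon> \<cdot>\<^sub>M
        (mat_transpose (lower_bidiagonal l m) \<cdot>\<^sub>M lower_bidiagonal l m) +\<^sub>M x *\<^sub>M mat_id)
        \<cdot>\<^sub>V (\<lambda>n. poly (P n) t)"
      by (simp add: JP Q_0 Q_Suc)
  qed
  with l m show ?thesis by blast
qed

section \<open>From the factorization to a measure\<close>

lemma GLtL_corresponds:
  assumes \<epsilon>: "\<And>j. \<epsilon> j \<in> {1, -1}" and l: "\<And>j. l j > 0" and m: "\<And>j. m j \<noteq> 0"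
  shows "\<exists>\<mu>. positive_measure \<mu> \<and> corresponds_to \<epsilon>
    (mat_diag \<epsilon> \<cdot>\<^sub>M (mat_transpose (lower_bidiagonal l m) \<cdot>\<^sub>M lower_bidiagonal l m)
      +\<^sub>M x *\<^sub>M mat_id) (signed_density \<mu> (\<lambda>t. t - x))"
proof -
  have \<epsilon>\<epsilon>: "\<epsilon> n * \<epsilon> n = 1" "\<epsilon> n \<noteq> 0" for n
    using \<epsilon>[of n] by auto
  \<comment> \<open>The entries of the Jacobi matrix \<open>L G L\<^sup>T + x I\<close>.\<close>
  define a where "a n = \<epsilon> n * l n * m n" for n
  define b where "b n = \<epsilon> n * (l n)\<^sup>2 + (case n of 0 \<Rightarrow> 0 | Suc k \<Rightarrow> \<epsilon> k * (m k)\<^sup>2) + x" for n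
  have lnz: "l n \<noteq> 0" for n
    using l[of n] by simp
  interpret jacobi a b
    by standard (simp add: a_def \<epsilon>\<epsilon> lnz m)
  obtain M where M: "positive_measure M"
      and orthM: "\<And>i j. integral\<^sup>L M (poly (Q i * Q j)) = (if i = j then 1 else 0)"
    using Favard by blast
  define w where "w = [:- x, 1:]"
  define I where "I p = integral\<^sup>L M (poly p)" for p
  interpret I: poly_functional I
    using poly_functional_integral[OF M, of 1] by (simp add: I_def[abs_def])
  have orthQ: "I (Q i * Q j) = (if i = j then 1 else 0)" for i j
    by (simp add: I_def orthM del: poly_mult)
  \<comment> \<open>Forward substitution in \<open>L p = q\<close>.\<close>
  define P where "P = rec_nat (smult (1 / l 0) (Q 0))
    (\<lambda>n p. smult (1 / l (Suc n)) (Q (Suc n) - smult (m n) p))"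
  have Q_0: "Q 0 = smult (l 0) (P 0)"
    by (simp add: P_def lnz)
  have Q_Suc: "Q (Suc n) = smult (l (Suc n)) (P (Suc n)) + smult (m n) (P n)" for n
    by (simp add: P_def lnz)
  have degP: "degree (P n) \<le> n \<and> coeff (P n) n = coeff (Q n) n / l n" for n
  proof (induction n)
    case 0
    show ?case by (simp add: P_def)
  next
    case (Suc n)
    have P: "P (Suc n) = smult (1 / l (Suc n)) (Q (Suc n) - smult (m n) (P n))"
      by (simp add: P_def)
    have "degree (Q (Suc n) - smult (m n) (P n)) \<le> Suc n"
      using Suc by (intro degree_diff_le) (auto simp: degree_Q intro: order_trans[OF degree_smult_le])
    then show ?case
      unfolding P using Suc by (auto simp: coeff_eq_0 intro: order_trans[OF degree_smult_le])
  qed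
  have lcQ: "coeff (Q n) n \<noteq> 0" for n
    using Q_nz[of n] degree_Q[of n] by (metis leading_coeff_0_iff)
  have deg: "degree (P n) = n" for n
    using degP[of n] lcQ[of n] lnz[of n] by (intro antisym le_degree) auto
  have split_w: "w * q = [:0, 1:] * q - smult x q" for q
    by (simp add: w_def)
  have wQ_0: "w * Q 0 = smult (b 0 - x) (Q 0) + smult (a 0) (Q (Suc 0))"
    unfolding split_w Q_recurrence_0 by (simp add: smult_diff_left)
  have wQ_Suc: "w * Q (Suc n) =
      smult (a n) (Q n) + smult (b (Suc n) - x) (Q (Suc n)) + smult (a (Suc n)) (Q (Suc (Suc n)))" for n
    unfolding split_w Q_recurrence_Suc by (simp add: smult_diff_left)
  \<comment> \<open>The recurrence of \<open>Q\<close> says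
    \<open>(t - x) L p = L G L\<^sup>T q\<close>. The factor \<open>L\<close> is cancelled row by
    row, its diagonal being nonzero.\<close>
  have wP: "w * P n = smult (\<epsilon> n) (smult (l n) (Q n) + smult (m n) (Q (Suc n)))" for n
  proof (induction n)
    case 0
    have "smult (l 0) (w * P 0) = w * Q 0"
      unfolding Q_0 by simp
    also have "\<dots> = smult (l 0) (smult (\<epsilon> 0) (smult (l 0) (Q 0) + smult (m 0) (Q (Suc 0))))"
      unfolding wQ_0 by (simp add: a_def b_def smult_add_right power2_eq_square mult_ac)
    finally show ?case
      using lnz[of 0] by (metis smult_cancel)
  next
    case (Suc n)
    have "smult (l (Suc n)) (w * P (Suc n)) = w * Q (Suc n) - smult (m n) (w * P n)"
      unfolding Q_Suc by (simp add: distrib_left)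
    also have "\<dots> = smult (l (Suc n))
        (smult (\<epsilon> (Suc n)) (smult (l (Suc n)) (Q (Suc n)) + smult (m (Suc n)) (Q (Suc (Suc n)))))"
      unfolding wQ_Suc Suc
      by (simp add: a_def b_def smult_add_right smult_add_left power2_eq_square mult_ac)
    finally show ?case
      using lnz[of "Suc n"] by (metis smult_cancel)
  qed
  have IQP: "I (Q i * P j) = (if i = j then 1 / l i else 0)" if "j \<le> i" for i j
  proof -
    have "I (Q i * P j) * coeff (Q i) i = (if i = j then 1 / l i else 0) * coeff (Q i) i"
      using I.orthogonal_lead_coeff[OF degree_Q Q_nz, of "P j" i] orthQ that deg[of j] degP[of i]
      by (auto simp: coeff_eq_0)
    then show ?thesis
      using lcQ[of i] by simp
  qed
  \<comment> \<open>Expanding \<open>w * P i\<close> by \<open>wP\<close> leaves products with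
    \<open>Q i\<close> and \<open>Q (Suc i)\<close>. For \<open>j \<le> i\<close> the second
    vanishes, and the first is \<open>1 / l i\<close> or zero.\<close>
  have orth_le: "I (w * (P i * P j)) = (if i = j then \<epsilon> i else 0)" if "j \<le> i" for i j
  proof -
    have "I (w * (P i * P j)) = I (w * P i * P j)"
      by (simp add: mult.assoc)
    also have "\<dots> = \<epsilon> i * (l i * I (Q i * P j) + m i * I (Q (Suc i) * P j))"
      unfolding wP by (simp add: distrib_right I.add I.smult)
    finally show ?thesis
      using IQP[of j i] IQP[of j "Suc i"] that lnz[of i] by auto
  qed
  have orth: "I (w * (P i * P j)) = (if i = j then \<epsilon> i else 0)" for i j
  proof (cases "j \<le> i")
    case False
    then show ?thesis
      using orth_le[of i j] unfolding mult.commute[of "P i" "P j"] by simp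
  qed (rule orth_le)
  let ?J = "mat_diag \<epsilon> \<cdot>\<^sub>M (mat_transpose (lower_bidiagonal l m) \<cdot>\<^sub>M lower_bidiagonal l m)
      +\<^sub>M x *\<^sub>M mat_id"
  have JP: "?J \<cdot>\<^sub>V (\<lambda>n. poly (P n) t) = (\<lambda>n. t * poly (P n) t)" for t
  proof (rule GLtL_mat_vec[where q = "\<lambda>n. poly (Q n) t"])
    show "poly (Q 0) t = l 0 * poly (P 0) t"
      by (simp only: Q_0 poly_smult)
    show "poly (Q (Suc n)) t = l (Suc n) * poly (P (Suc n)) t + m n * poly (P n) t" for n
      by (simp only: Q_Suc poly_smult poly_add)
    show "(t - x) * poly (P n) t = \<epsilon> n * (l n * poly (Q n) t + m n * poly (Q (Suc n)) t)" for n
      using arg_cong[OF wP[of n], of "\<lambda>p. poly p t"] by (simp add: w_def algebra_simps)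
  qed
  have "signed_integral (signed_density M (\<lambda>t. t - x)) (\<lambda>t. poly (P i) t * poly (P j) t) =
      (if i = j then \<epsilon> i else 0)" for i j
    using signed_density_linear(2)[OF M, of x "P i * P j"] orth[of i j]
    by (simp add: I_def w_def poly_mult[abs_def] del: mult_pCons_left)
  then have "corresponds_to \<epsilon> ?J (signed_density M (\<lambda>t. t - x))"
    unfolding corresponds_to_def using signed_density_linear(1)[OF M] deg JP by blast
  with M show ?thesis by blast
qed

theorem theorem2p3:
  fixes \<epsilon> :: "nat \<Rightarrow> real" and J :: inf_matrix and x :: real
  assumes "\<And>j. \<epsilon> j \<in> {1, -1}"
    and "tridiagonal J"
    and "G_symmetric (mat_diag \<epsilon>) J"
  shows "(\<exists>\<mu>. positive_measure \<mu> \<and> corresponds_to \<epsilon> J (signed_density \<mu> (\<lambda>t. t - x))) \<longleftrightarrow>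
    (\<exists>l m. (\<forall>j. l j > 0) \<and> (\<forall>j. m j \<noteq> 0) \<and>
       J = mat_diag \<epsilon> \<cdot>\<^sub>M (mat_transpose (lower_bidiagonal l m) \<cdot>\<^sub>M lower_bidiagonal l m)
             +\<^sub>M x *\<^sub>M mat_id)"
proof
  assume "\<exists>\<mu>. positive_measure \<mu> \<and> corresponds_to \<epsilon> J (signed_density \<mu> (\<lambda>t. t - x))"
  then obtain M P where M: "positive_measure M" and deg: "\<And>n. degree (P n) = n"
    and orth: "\<And>n m. signed_integral (signed_density M (\<lambda>t. t - x))
      (\<lambda>t. poly (P n) t * poly (P m) t) = (if n = m then \<epsilon> n else 0)"
    and JP: "\<And>t. J \<cdot>\<^sub>V (\<lambda>n. poly (P n) t) = (\<lambda>n. t * poly (P n) t)"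
    unfolding corresponds_to_def by blast
  have "integral\<^sup>L M (poly ([:- x, 1:] * (P n * P m))) = (if n = m then \<epsilon> n else 0)" for n m
    using signed_density_linear(2)[OF M, of x "P n * P m"] orth[of n m]
    by (simp add: poly_mult[abs_def] del: mult_pCons_left)
  from corresponding_matrix[OF assms(1,2) M deg this JP]
  show "\<exists>l m. (\<forall>j. l j > 0) \<and> (\<forall>j. m j \<noteq> 0) \<and>
       J = mat_diag \<epsilon> \<cdot>\<^sub>M (mat_transpose (lower_bidiagonal l m) \<cdot>\<^sub>M lower_bidiagonal l m)
             +\<^sub>M x *\<^sub>M mat_id" .
next
  assume "\<exists>l m. (\<forall>j. l j > 0) \<and> (\<forall>j. m j \<noteq> 0) \<and>
       J = mat_diag \<epsilon> \<cdot>\<^sub>M (mat_transpose (lower_bidiagonal l m) \<cdot>\<^sub>M lower_bidiagonal l m)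
             +\<^sub>M x *\<^sub>M mat_id"
  then show "\<exists>\<mu>. positive_measure \<mu> \<and> corresponds_to \<epsilon> J (signed_density \<mu> (\<lambda>t. t - x))"
    using GLtL_corresponds[where \<epsilon> = \<epsilon>, OF assms(1)] by blast
qed

end
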